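(* For every real number $t$ with $1<t<\sqrt{5}/2$, the hypersurface $M_t^3$ admits a real-analytic CR-embedding in $\mathbb{C}^3$.
   Context: Let $Q^3:=\{(z_1,z_2,z_3,z_4)\in\mathbb{C}^4: z_1^2+z_2^2+z_3^2+z_4^2=1\}$ be the affine complex quadric, a complex submanifold of $\mathbb{C}^4$ of complex dimension $3$. For $t>1$ let $$M_t^3:=\{(z_1,z_2,z_3,z_4)\in\mathbb{C}^4: |z_1|^2+|z_2|^2+|z_3|^2+|z_4|^2=t\}\cap Q^3,$$ which is a compact strongly pseudoconvex real-analytic hypersurface in $Q^3$; it carries the CR-structure induced from the complex manifold $Q^3$, i.e. the complex tangent space at $p$ is $T_pM_t^3\cap i\,T_pM_t^3$ (intersection inside $T_pQ^3$). A real-analytic CR-embedding of $M_t^3$ in $\mathbb{C}^3$ is a real-analytic map $M_t^3\to\mathbb{C}^3$ that is an embedding (an injective immersion that is a homeomorphism onto its image) and is a CR-map, i.e. its differential restricted to each complex tangent space of $M_t^3$ is complex-linear. *)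

theory Defs
  imports "HOL-Analysis.Analysis"
begin

definition Q3 :: "(complex^4) set" where
  "Q3 = {z. (z$1)^2 + (z$2)^2 + (z$3)^2 + (z$4)^2 = 1}"

definition M3 :: "real \<Rightarrow> (complex^4) set" where
  "M3 t = {z. (cmod (z$1))^2 + (cmod (z$2))^2 + (cmod (z$3))^2 + (cmod (z$4))^2 = t} \<inter> Q3"

text \<open>
  Real-analyticity at \<open>p\<close>: locally the sum of an unconditionally convergent power series in the
  real coordinates. The multi-indices \<open>\<alpha>\<close> are the extensional functions from the basis to the
  naturals.
\<close>

definition real_analytic_at :: "('a::euclidean_space \<Rightarrow> 'b::euclidean_space) \<Rightarrow> 'a \<Rightarrow> bool" where
  "real_analytic_at f p \<longleftrightarrow>
     (\<exists>r>0. \<exists>c :: ('a \<Rightarrow> nat) \<Rightarrow> 'b. \<forall>x\<in>ball p r.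
        ((\<lambda>\<alpha>. (\<Prod>b\<in>Basis. ((x - p) \<bullet> b) ^ \<alpha> b) *\<^sub>R c \<alpha>) has_sum f x)
          (Basis \<rightarrow>\<^sub>E (UNIV :: nat set)))"

text \<open>
  In the following definitions \<open>M\<close> is meant to be an embedded real-analytic submanifold of the
  ambient space. Maps on \<open>M\<close> are represented by total functions whose values outside \<open>M\<close> are
  irrelevant. A map on an embedded real-analytic submanifold is real-analytic iff it extends
  real-analytically to an ambient neighbourhood of each point.
\<close>

definition real_analytic_map_on ::
    "'a::euclidean_space set \<Rightarrow> ('a \<Rightarrow> 'b::euclidean_space) \<Rightarrow> bool" where
  "real_analytic_map_on M f \<longleftrightarrow>
     (\<forall>p\<in>M. \<exists>U g. open U \<and> p \<in> U \<and> (\<forall>x\<in>U. real_analytic_at g x) \<and> (\<forall>x\<in>U \<inter> M. f x = g x))"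

text \<open>Velocities at \<open>p\<close> of continuously differentiable curves in \<open>M\<close>.\<close>

definition tangent_space :: "'a::real_normed_vector set \<Rightarrow> 'a \<Rightarrow> 'a set" where
  "tangent_space M p =
     {v. \<exists>\<gamma> \<epsilon>. \<epsilon> > 0 \<and> \<gamma> C1_differentiable_on {-\<epsilon><..<\<epsilon>} \<and> \<gamma> ` {-\<epsilon><..<\<epsilon>} \<subseteq> M \<and>
              \<gamma> 0 = p \<and> (\<gamma> has_vector_derivative v) (at (0::real))}"

text \<open>
  The differential of \<open>f\<close> at \<open>p \<in> M\<close> is the restriction to \<open>tangent_space M p\<close> of any derivative
  \<open>D\<close> of \<open>f\<close> at \<open>p\<close> within \<open>M\<close>. Such a \<open>D\<close> sees \<open>f\<close> only on \<open>M\<close>; it need not be unique on the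
  ambient space, but by the chain rule \<open>D v\<close> is the velocity of \<open>f \<circ> \<gamma>\<close> for every curve \<open>\<gamma>\<close> in \<open>M\<close>
  with velocity \<open>v\<close>, so its restriction is.
\<close>

definition immersion_on ::
    "'a::real_normed_vector set \<Rightarrow> ('a \<Rightarrow> 'b::real_normed_vector) \<Rightarrow> bool" where
  "immersion_on M f \<longleftrightarrow>
     (\<forall>p\<in>M. \<exists>D. (f has_derivative D) (at p within M) \<and> inj_on D (tangent_space M p))"

definition embedding_on ::
    "'a::real_normed_vector set \<Rightarrow> ('a \<Rightarrow> 'b::real_normed_vector) \<Rightarrow> bool" where
  "embedding_on M f \<longleftrightarrow>
     inj_on f M \<and> immersion_on M f \<and> (\<exists>g. homeomorphism M (f ` M) f g)"

text \<open>
  The complex structure on the tangent spaces of a complex submanifold of \<open>\<complex>\<^sup>n\<close>, such as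
  \<open>Q3\<close>, is multiplication by \<open>\<i>\<close> in \<open>\<complex>\<^sup>n\<close>, so \<open>T \<inter> iT\<close> can be formed in \<open>\<complex>\<^sup>n\<close>.
\<close>

definition complex_tangent_space :: "(complex^'n) set \<Rightarrow> complex^'n \<Rightarrow> (complex^'n) set" where
  "complex_tangent_space M p = tangent_space M p \<inter> (\<lambda>v. \<i> *s v) ` tangent_space M p"

definition CR_map_on :: "(complex^'n) set \<Rightarrow> (complex^'n \<Rightarrow> complex^'m) \<Rightarrow> bool" where
  "CR_map_on M f \<longleftrightarrow>
     (\<forall>p\<in>M. \<exists>D. (f has_derivative D) (at p within M) \<and>
        (\<forall>v\<in>complex_tangent_space M p. \<forall>c. D (c *s v) = c *s D v))"

definition real_analytic_CR_embedding ::
    "(complex^'n) set \<Rightarrow> (complex^'n \<Rightarrow> complex^'m) \<Rightarrow> bool" where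
  "real_analytic_CR_embedding M f \<longleftrightarrow>
     real_analytic_map_on M f \<and> embedding_on M f \<and> CR_map_on M f"

end

theory Submission
  imports Defs
begin

text \<open>
  In the null coordinates \<open>a = z\<^sub>1 + \<i>z\<^sub>2\<close>, \<open>b = z\<^sub>1 - \<i>z\<^sub>2\<close>, \<open>c = z\<^sub>3 + \<i>z\<^sub>4\<close>,
  \<open>d = z\<^sub>3 - \<i>z\<^sub>4\<close> the quadric is \<open>ab + cd = 1\<close>, and on \<open>M3 t\<close> the sum
  \<open>\<bar>a\<bar>\<^sup>2 + \<bar>b\<bar>\<^sup>2 + \<bar>c\<bar>\<^sup>2 + \<bar>d\<bar>\<^sup>2\<close> is \<open>2t\<close>. The fibres of \<open>(a, c)\<close> on the quadric are the
  complex lines \<open>(b + sc, d - sa)\<close>. So \<open>(a, c, P)\<close> is an embedding as soon as the holomorphic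
  function \<open>P\<close> is injective and immersive on the part of each such line that lies in \<open>M3 t\<close>.
  Being a holomorphic polynomial map it is real-analytic and CR, and injectivity on the compact set
  \<open>M3 t\<close> makes it a homeomorphism onto its image.

  A natural parameter on a line is \<open>u = ab\<close>, with \<open>1 - u = cd\<close>. If \<open>h\<close> is a polynomial vanishing
  at \<open>0\<close> and \<open>1\<close>, say \<open>h(u) = u(1 - u)Q(u)\<close>, then \<open>P = bdQ(ab)\<close> satisfies \<open>acP = h(u)\<close>,
  and since \<open>u\<close> has slope \<open>ac\<close> in \<open>s\<close>, the difference quotient of \<open>P\<close> in \<open>s\<close> equals that of
  \<open>h\<close> in \<open>u\<close>; read as a polynomial identity in both points, this includes \<open>ac = 0\<close>. Choose \<open>h\<close> to be \<open>- (u - \<tau>)\<^sup>3\<close> up to an additive constant.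
  The vanishing of \<open>h\<close> at \<open>0\<close> and \<open>1\<close> forces \<open>\<tau>\<^sup>3 = (\<tau> - 1)\<^sup>3\<close>, that is
  \<open>3\<tau>\<^sup>2 = 3\<tau> - 1\<close>, and then \<open>Q(u) = u - 3\<tau>\<^sup>2\<close>. With \<open>z = u - \<tau>\<close> and \<open>z' = u' - \<tau>\<close>, both
  the injectivity of \<open>P\<close> and (for \<open>z = z'\<close>) the immersion property reduce to
  \<open>z\<^sup>2 + zz' + z'\<^sup>2 \<noteq> 0\<close>.

  On a fixed fibre in \<open>M3 t\<close> the values of \<open>u\<close> lie on a circle with real centre
  \<open>r = \<bar>a\<bar>\<^sup>2 / (\<bar>a\<bar>\<^sup>2 + \<bar>c\<bar>\<^sup>2)\<close> and squared radius at most \<open>r(1 - r)(t\<^sup>2 - 1)\<close>. Zeros of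
  the quadratic form are pairs \<open>z, z'\<close> that differ by a rotation by 120 degrees about the origin
  (or vanish), and a circle contains no such pair if its squared radius is less than three
  quarters of the squared distance of its centre from the origin. Here that squared distance is
  \<open>\<bar>r - \<tau>\<bar>\<^sup>2 = (r - 1/2)\<^sup>2 + 1/12\<close>, and the required inequality follows from
  \<open>t\<^sup>2 < 5/4\<close>. This is \<open>fibre_cubic_factor_nonzero\<close>, the heart of the proof.
\<close>

section \<open>Polynomial maps are real-analytic\<close>

definition shifted_monomial :: "'a::euclidean_space \<Rightarrow> ('a \<Rightarrow> nat) \<Rightarrow> 'a \<Rightarrow> real" where
  "shifted_monomial p \<alpha> x = (\<Prod>b\<in>Basis. ((x - p) \<bullet> b) ^ \<alpha> b)"

text \<open>
  A polynomial written in powers of the coordinates of \<open>x - p\<close>. The exponents are extensional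
  functions, so that such a sum is a finitely supported power series in the sense of
  \<open>real_analytic_at\<close>.
\<close>
definition has_finite_expansion ::
    "'a::euclidean_space \<Rightarrow> ('a \<Rightarrow> 'b::real_vector) \<Rightarrow> bool" where
  "has_finite_expansion p f \<longleftrightarrow>
     (\<exists>A c. finite A \<and> A \<subseteq> Basis \<rightarrow>\<^sub>E (UNIV :: nat set) \<and>
        (\<forall>x. f x = (\<Sum>\<alpha>\<in>A. shifted_monomial p \<alpha> x *\<^sub>R c \<alpha>)))"

lemma has_finite_expansionI:
  assumes "finite A" "A \<subseteq> Basis \<rightarrow>\<^sub>E (UNIV :: nat set)"
    "\<And>x. f x = (\<Sum>\<alpha>\<in>A. shifted_monomial p \<alpha> x *\<^sub>R c \<alpha>)"
  shows "has_finite_expansion p f"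
  using assms unfolding has_finite_expansion_def by blast

lemma has_finite_expansion_shifted_monomial:
  "has_finite_expansion p (\<lambda>x. shifted_monomial p \<alpha> x *\<^sub>R v)"
proof (rule has_finite_expansionI[where A = "{restrict \<alpha> Basis}" and c = "\<lambda>_. v"])
  have "shifted_monomial p (restrict \<alpha> Basis) x = shifted_monomial p \<alpha> x" for x
    unfolding shifted_monomial_def by (rule prod.cong) auto
  then show "shifted_monomial p \<alpha> x *\<^sub>R v
      = (\<Sum>\<beta>\<in>{restrict \<alpha> Basis}. shifted_monomial p \<beta> x *\<^sub>R v)" for x
    by simp
qed auto

lemma has_finite_expansion_add:
  assumes "has_finite_expansion p f" "has_finite_expansion p g"
  shows "has_finite_expansion p (\<lambda>x. f x + g x)"
proof -
  obtain A c where A: "finite A" "A \<subseteq> Basis \<rightarrow>\<^sub>E (UNIV :: nat set)"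
      "\<And>x. f x = (\<Sum>\<alpha>\<in>A. shifted_monomial p \<alpha> x *\<^sub>R c \<alpha>)"
    using assms(1) unfolding has_finite_expansion_def by blast
  obtain B d where B: "finite B" "B \<subseteq> Basis \<rightarrow>\<^sub>E (UNIV :: nat set)"
      "\<And>x. g x = (\<Sum>\<alpha>\<in>B. shifted_monomial p \<alpha> x *\<^sub>R d \<alpha>)"
    using assms(2) unfolding has_finite_expansion_def by blast
  define e where "e \<alpha> = (if \<alpha> \<in> A then c \<alpha> else 0) + (if \<alpha> \<in> B then d \<alpha> else 0)" for \<alpha>
  show ?thesis
  proof (rule has_finite_expansionI[where A = "A \<union> B" and c = e])
    fix x
    have "f x = (\<Sum>\<alpha>\<in>A \<union> B. shifted_monomial p \<alpha> x *\<^sub>R (if \<alpha> \<in> A then c \<alpha> else 0))"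
      unfolding A(3) by (rule sum.mono_neutral_cong_left) (use A B in auto)
    moreover have "g x = (\<Sum>\<alpha>\<in>A \<union> B. shifted_monomial p \<alpha> x *\<^sub>R (if \<alpha> \<in> B then d \<alpha> else 0))"
      unfolding B(3) by (rule sum.mono_neutral_cong_left) (use A B in auto)
    ultimately show "f x + g x = (\<Sum>\<alpha>\<in>A \<union> B. shifted_monomial p \<alpha> x *\<^sub>R e \<alpha>)"
      by (simp add: e_def scaleR_add_right sum.distrib)
  qed (use A B in auto)
qed

lemma has_finite_expansion_const: "has_finite_expansion p (\<lambda>x. v)"
  using has_finite_expansion_shifted_monomial[of p "\<lambda>_. 0" v]
  by (simp add: shifted_monomial_def)

lemma has_finite_expansion_sum:
  assumes "\<And>i. i \<in> I \<Longrightarrow> has_finite_expansion p (f i)"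
  shows "has_finite_expansion p (\<lambda>x. \<Sum>i\<in>I. f i x)"
  using assms
  by (induction I rule: infinite_finite_induct)
     (auto intro: has_finite_expansion_add has_finite_expansion_const)

text \<open>
  The sums \<open>\<alpha> + \<beta>\<close> of exponents repeat and are not extensional; it is enough that each single
  term of the expanded product has a finite expansion, because these are closed under sums.
\<close>
lemma has_finite_expansion_scaleR:
  assumes "has_finite_expansion p f" "has_finite_expansion p g"
  shows "has_finite_expansion p (\<lambda>x. f x *\<^sub>R g x)"
proof -
  obtain A c where A: "\<And>x. f x = (\<Sum>\<alpha>\<in>A. shifted_monomial p \<alpha> x *\<^sub>R c \<alpha>)"
    using assms(1) unfolding has_finite_expansion_def by blast
  obtain B d where B: "\<And>x. g x = (\<Sum>\<beta>\<in>B. shifted_monomial p \<beta> x *\<^sub>R d \<beta>)"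
    using assms(2) unfolding has_finite_expansion_def by blast
  have "shifted_monomial p (\<lambda>b. \<alpha> b + \<beta> b) x = shifted_monomial p \<alpha> x * shifted_monomial p \<beta> x"
    for \<alpha> \<beta> x
    by (simp add: shifted_monomial_def power_add prod.distrib)
  then have "(\<lambda>x. f x *\<^sub>R g x)
      = (\<lambda>x. \<Sum>\<alpha>\<in>A. \<Sum>\<beta>\<in>B. shifted_monomial p (\<lambda>b. \<alpha> b + \<beta> b) x *\<^sub>R c \<alpha> *\<^sub>R d \<beta>)"
    unfolding A scaleR_sum_left by (simp add: B scaleR_sum_right mult_ac)
  then show ?thesis
    by (simp only: has_finite_expansion_sum has_finite_expansion_shifted_monomial)
qed

lemma has_finite_expansion_coordinate:
  assumes "b \<in> Basis"
  shows "has_finite_expansion p (\<lambda>x. (x - p) \<bullet> b)"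
proof -
  have "shifted_monomial p (\<lambda>b'. if b' = b then 1 else 0) x = (x - p) \<bullet> b" for x
  proof -
    have "shifted_monomial p (\<lambda>b'. if b' = b then 1 else 0) x
        = (\<Prod>b'\<in>Basis. if b' = b then (x - p) \<bullet> b' else 1)"
      unfolding shifted_monomial_def by (rule prod.cong) auto
    then show ?thesis using assms by simp
  qed
  then show ?thesis
    using has_finite_expansion_shifted_monomial[of p "\<lambda>b'. if b' = b then 1 else 0" "1::real"]
    by simp
qed

lemma real_polynomial_function_has_finite_expansion:
  assumes "real_polynomial_function f"
  shows "has_finite_expansion p f"
  using assms
proof (induction rule: real_polynomial_function.induct)
  case (linear f)
  interpret bounded_linear f by fact
  have f_eq: "f = (\<lambda>x. f p + (\<Sum>b\<in>Basis. ((x - p) \<bullet> b) *\<^sub>R f b))"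
  proof
    fix x
    have "f x = f p + f (x - p)" by (simp add: diff)
    also have "f (x - p) = f (\<Sum>b\<in>Basis. ((x - p) \<bullet> b) *\<^sub>R b)"
      by (simp only: euclidean_representation)
    also have "\<dots> = (\<Sum>b\<in>Basis. ((x - p) \<bullet> b) *\<^sub>R f b)"
      by (simp only: sum scaleR)
    finally show "f x = f p + (\<Sum>b\<in>Basis. ((x - p) \<bullet> b) *\<^sub>R f b)" .
  qed
  have "has_finite_expansion p (\<lambda>x. f p + (\<Sum>b\<in>Basis. ((x - p) \<bullet> b) *\<^sub>R f b))"
    by (intro has_finite_expansion_add has_finite_expansion_const has_finite_expansion_sum
        has_finite_expansion_scaleR has_finite_expansion_coordinate)
  then show ?case by (subst f_eq)
next
  case (mult f g)
  then show ?case using has_finite_expansion_scaleR[of p f g] by simp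
qed (simp_all add: has_finite_expansion_const has_finite_expansion_add)

lemma has_finite_expansion_imp_real_analytic_at:
  assumes "has_finite_expansion p f"
  shows "real_analytic_at f p"
proof -
  obtain A c where A: "finite A" "A \<subseteq> Basis \<rightarrow>\<^sub>E (UNIV :: nat set)"
      "\<And>x. f x = (\<Sum>\<alpha>\<in>A. shifted_monomial p \<alpha> x *\<^sub>R c \<alpha>)"
    using assms unfolding has_finite_expansion_def by blast
  have "((\<lambda>\<alpha>. (\<Prod>b\<in>Basis. ((x - p) \<bullet> b) ^ \<alpha> b) *\<^sub>R (if \<alpha> \<in> A then c \<alpha> else 0)) has_sum f x)
          (Basis \<rightarrow>\<^sub>E (UNIV :: nat set))" for x
    using A by (intro has_sum_finite_neutralI[of A]) (auto simp: shifted_monomial_def)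
  then show ?thesis
    unfolding real_analytic_at_def by (meson zero_less_one)
qed

lemma polynomial_function_real_analytic_at:
  fixes f :: "'a::euclidean_space \<Rightarrow> 'b::euclidean_space"
  assumes "polynomial_function f"
  shows "real_analytic_at f p"
proof -
  have "has_finite_expansion p (\<lambda>x. f x \<bullet> b)" for b
    using assms
    by (intro real_polynomial_function_has_finite_expansion)
       (auto simp: polynomial_function_def o_def bounded_linear_inner_left)
  then have "has_finite_expansion p (\<lambda>x. \<Sum>b\<in>Basis. (f x \<bullet> b) *\<^sub>R b)"
    by (intro has_finite_expansion_sum has_finite_expansion_scaleR has_finite_expansion_const)
  then show ?thesis
    unfolding euclidean_representation by (rule has_finite_expansion_imp_real_analytic_at)
qed

lemma polynomial_function_bounded_linear_compose:
  fixes h :: "'c::real_normed_vector \<Rightarrow> 'b::real_normed_vector"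
  assumes "bounded_linear h" "polynomial_function f"
  shows "polynomial_function (\<lambda>x. h (f x))"
  unfolding polynomial_function_def o_def
proof (intro allI impI)
  fix g :: "'b \<Rightarrow> real"
  assume "bounded_linear g"
  then have "bounded_linear (\<lambda>x. g (h x))" using assms(1) by (rule bounded_linear_compose)
  then show "real_polynomial_function (\<lambda>x. g (h (f x)))"
    using assms(2)[unfolded polynomial_function_def o_def, rule_format, of "\<lambda>y. g (h y)"]
    by simp
qed

lemma polynomial_function_complex_mult:
  fixes f g :: "'a::real_normed_vector \<Rightarrow> complex"
  assumes "polynomial_function f" "polynomial_function g"
  shows "polynomial_function (\<lambda>x. f x * g x)"
proof -
  have "(\<lambda>x. f x * g x) = (\<lambda>x. Re (f x) *\<^sub>R g x + Im (f x) *\<^sub>R (\<i> * g x))"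
    by (simp add: fun_eq_iff complex_eq_iff)
  moreover have "polynomial_function (\<lambda>x. Re (f x) *\<^sub>R g x + Im (f x) *\<^sub>R (\<i> * g x))"
    using assms
    by (intro polynomial_function_add polynomial_function_mult
        polynomial_function_bounded_linear_compose[OF bounded_linear_Re]
        polynomial_function_bounded_linear_compose[OF bounded_linear_Im]
        polynomial_function_bounded_linear_compose[OF bounded_linear_mult_right])
  ultimately show ?thesis by simp
qed

section \<open>The cubic on the fibres of \<open>(a, c)\<close>\<close>

text \<open>
  One of the two roots of \<open>3\<tau>\<^sup>2 = 3\<tau> - 1\<close>; the other is its conjugate. Both have the same distance
  from every real point.
\<close>
definition \<tau> :: complex where
  "\<tau> = Complex (1/2) (- sqrt 3 / 6)"

lemma \<tau>_quadratic: "3 * \<tau>^2 = 3 * \<tau> - 1"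
  by (simp add: \<tau>_def complex_eq_iff power2_eq_square)

definition fibre_polynomial :: "complex \<Rightarrow> complex \<Rightarrow> complex \<Rightarrow> complex \<Rightarrow> complex" where
  "fibre_polynomial a b c d = b * d * (a * b - 3 * \<tau>^2)"

text \<open>
  For \<open>ac \<noteq> 0\<close> this is the factorization of a difference of cubes divided by \<open>ac\<close>, since
  \<open>ac\<close> times the polynomial is \<open>- (ab - \<tau>)\<^sup>3\<close> up to a constant on the quadric and
  \<open>ab' - ab = s(ac)\<close>.
\<close>
lemma fibre_polynomial_diff:
  assumes "a * b + c * d = 1" "b' = b + s * c" "d' = d - s * a"
  shows "fibre_polynomial a b' c d' - fibre_polynomial a b c d
    = - s * ((a * b - \<tau>)^2 + (a * b - \<tau>) * (a * b' - \<tau>) + (a * b' - \<tau>)^2)"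
  unfolding fibre_polynomial_def using assms \<tau>_quadratic by algebra

lemma quadric_fibre_is_line:
  fixes a b c d b' d' :: complex
  assumes "a * b + c * d = 1" "a * b' + c * d' = 1"
  obtains s where "b' = b + s * c" "d' = d - s * a"
proof
  \<comment> \<open>Cramer's rule in the basis \<open>(b, d)\<close>, \<open>(c, - a)\<close>, whose determinant is \<open>- (ab + cd) = - 1\<close>\<close>
  show "b' = b + ((b' - b) * d - (d' - d) * b) * c" using assms by algebra
  show "d' = d - ((b' - b) * d - (d' - d) * b) * a" using assms by algebra
qed

text \<open>
  The hypothesis gives \<open>\<bar>d\<bar>\<^sup>2 = 3\<bar>m\<bar>\<^sup>2\<close>, and the bound is then the Cauchy--Schwarz inequality for
  \<open>\<bar>q\<bar> \<le> \<bar>m - q\<bar> + (\<surd>3 \<bar>m\<bar>) / \<surd>3\<close>. It is applied to the midpoint \<open>m\<close> and the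
  half difference \<open>d\<close> of two points of a circle with centre \<open>q\<close>, for which
  \<open>\<bar>m - q\<bar>\<^sup>2 + \<bar>d\<bar>\<^sup>2\<close> is the squared radius.
\<close>
lemma norm_le_of_quadratic_form_zero:
  fixes m d q :: complex
  assumes "3 * m^2 + d^2 = 0"
  shows "(cmod q)^2 \<le> 4/3 * ((cmod (m - q))^2 + (cmod d)^2)"
proof -
  have "d^2 = - 3 * m^2" using assms by (simp add: add_eq_0_iff)
  then have "cmod (d^2) = cmod (- 3 * m^2)" by simp
  then have d: "(cmod d)^2 = 3 * (cmod m)^2" by (simp add: norm_mult norm_power)
  have "cmod q \<le> cmod m + cmod (m - q)"
    by (metis norm_minus_commute norm_triangle_sub)
  then have "(cmod q)^2 \<le> (cmod m + cmod (m - q))^2" by (simp add: power_mono)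
  also have "\<dots> \<le> 4/3 * ((cmod (m - q))^2 + 3 * (cmod m)^2)"
    using zero_le_power2[of "cmod (m - q) - 3 * cmod m"]
    by (simp add: power2_eq_square field_simps)
  finally show ?thesis by (simp add: d)
qed

text \<open>
  The point of the line \<open>ab + cd = 1\<close> (for fixed \<open>a, c\<close>) nearest to the origin is
  \<open>(cnj a, cnj c) / S\<close>, and \<open>(b, d)\<close> is this point plus the orthogonal vector
  \<open>\<sigma>(c, - a)\<close>. The first equation reads off \<open>ab\<close>, and the second is the theorem of Pythagoras
  multiplied by \<open>S\<close>. So fixing the norm of \<open>(b, d)\<close> fixes \<open>\<bar>\<sigma>\<bar>\<close> and puts \<open>ab\<close> on a circle.
\<close>
lemma fibre_parametrization:
  fixes a b c d :: complex
  assumes "a * b + c * d = 1"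
  defines "S \<equiv> (cmod a)^2 + (cmod c)^2"
  obtains \<sigma> where "a * b = of_real ((cmod a)^2 / S) + \<sigma> * (a * c)"
    "S * ((cmod b)^2 + (cmod d)^2) = 1 + (cmod \<sigma>)^2 * S^2" "S > 0"
proof -
  have "a \<noteq> 0 \<or> c \<noteq> 0" using assms by auto
  then have S: "S > 0" unfolding S_def by (auto simp: add_pos_nonneg add_nonneg_pos)
  have SS: "complex_of_real S = a * cnj a + c * cnj c"
    unfolding S_def by (simp add: complex_norm_square[symmetric])
  define \<rho> where "\<rho> = b * cnj c - d * cnj a"
  have 1: "a * b * of_real S = a * cnj a + \<rho> * (a * c)"
    unfolding SS \<rho>_def using assms(1) by algebra
  have 1: "a * b = of_real ((cmod a)^2 / S) + (\<rho> / of_real S) * (a * c)"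
    using 1 S by (simp add: complex_norm_square[symmetric] field_simps)
  have "complex_of_real (S * ((cmod b)^2 + (cmod d)^2)) = of_real (1 + (cmod \<rho>)^2)"
  proof -
    have "cnj a * cnj b + cnj c * cnj d = 1"
      using arg_cong[OF assms(1), of cnj] by simp
    then have "(a * cnj a + c * cnj c) * (b * cnj b + d * cnj d)
        = 1 + (b * cnj c - d * cnj a) * (cnj b * c - cnj d * a)"
      using assms(1) by algebra
    then show ?thesis
      by (simp only: of_real_add of_real_mult of_real_1 SS complex_norm_square \<rho>_def
          complex_cnj_diff complex_cnj_mult complex_cnj_cnj)
  qed
  then have "S * ((cmod b)^2 + (cmod d)^2) = 1 + (cmod \<rho>)^2"
    by (simp only: of_real_eq_iff)
  then have 2: "S * ((cmod b)^2 + (cmod d)^2) = 1 + (cmod (\<rho> / of_real S))^2 * S^2"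
    using S by (simp add: norm_divide power_divide)
  from that[OF 1 2 S] show thesis .
qed

text \<open>
  In the proof, \<open>K = S(2t - S) - 1 = t\<^sup>2 - 1 - (S - t)\<^sup>2 < 1/4\<close> and the circle on which
  \<open>ab\<close> and \<open>ab'\<close> lie has squared radius \<open>Kr(1 - r)\<close>. If the form vanished, the preceding bound
  on the centre would give \<open>(r - 1/2)\<^sup>2 + 1/12 \<le> 4/3 Kr(1 - r) \<le> 1/3 r(1 - r)\<close>. As the right-hand
  side is \<open>1/12 - (r - 1/2)\<^sup>2 / 3\<close>, this leaves only \<open>r = 1/2\<close>, where \<open>K < 1/4\<close> makes the
  second inequality strict.
\<close>
lemma fibre_cubic_factor_nonzero:
  fixes a b c d b' d' :: complex and t :: real
  assumes q: "a * b + c * d = 1" and q': "a * b' + c * d' = 1"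
    and n: "(cmod a)^2 + (cmod b)^2 + (cmod c)^2 + (cmod d)^2 = 2 * t"
    and n': "(cmod a)^2 + (cmod b')^2 + (cmod c)^2 + (cmod d')^2 = 2 * t"
    and t: "t^2 < 5/4"
  shows "(a * b - \<tau>)^2 + (a * b - \<tau>) * (a * b' - \<tau>) + (a * b' - \<tau>)^2 \<noteq> 0"
proof
  assume zero: "(a * b - \<tau>)^2 + (a * b - \<tau>) * (a * b' - \<tau>) + (a * b' - \<tau>)^2 = 0"
  define S where "S = (cmod a)^2 + (cmod c)^2"
  define r where "r = (cmod a)^2 / S"
  obtain \<sigma> where s: "a * b = of_real r + \<sigma> * (a * c)"
    "S * ((cmod b)^2 + (cmod d)^2) = 1 + (cmod \<sigma>)^2 * S^2" "S > 0"
    using fibre_parametrization[OF q] unfolding S_def r_def by blast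
  obtain \<sigma>' where s': "a * b' = of_real r + \<sigma>' * (a * c)"
    "S * ((cmod b')^2 + (cmod d')^2) = 1 + (cmod \<sigma>')^2 * S^2"
    using fibre_parametrization[OF q'] unfolding S_def r_def by blast
  have bd: "(cmod b)^2 + (cmod d)^2 = 2 * t - S" "(cmod b')^2 + (cmod d')^2 = 2 * t - S"
    using n n' by (simp_all add: S_def)
  define K where "K = (cmod \<sigma>)^2 * S^2"
  have K: "K = S * (2 * t - S) - 1" using s(2) bd(1) by (simp add: K_def)
  have K': "K = (cmod \<sigma>')^2 * S^2" using s'(2) bd(2) K by simp
  have "K = t^2 - 1 - (S - t)^2" using K by (simp add: power2_eq_square algebra_simps)
  with t have K_less: "K < 1/4" using zero_le_power2[of "S - t"] by linarith
  have "(cmod c)^2 = S - (cmod a)^2" by (simp add: S_def)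
  then have r1: "(cmod c)^2 / S = 1 - r" using s(3) by (simp add: r_def diff_divide_distrib)
  have r: "0 \<le> r" "r \<le> 1" using s(3) r1[symmetric] by (simp_all add: r_def S_def)
  have ac: "(cmod (x * (a * c)))^2 = (cmod x)^2 * S^2 * (r * (1 - r))" for x
  proof -
    have "(cmod a)^2 = S * r" "(cmod c)^2 = S * (1 - r)"
      using s(3) unfolding r1[symmetric] by (simp_all add: r_def)
    then show ?thesis by (simp add: norm_mult power_mult_distrib) (simp add: power2_eq_square)
  qed
  define p where "p = of_real r - \<tau>"
  \<comment> \<open>Midpoint and half difference turn \<open>z\<^sup>2 + zz' + z'\<^sup>2\<close> into \<open>3m\<^sup>2 + h\<^sup>2\<close>.\<close>
  define m where "m = p + (\<sigma> + \<sigma>')/2 * (a * c)"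
  define h where "h = (\<sigma> - \<sigma>')/2 * (a * c)"
  have "a * b - \<tau> = m + h" "a * b' - \<tau> = m - h"
    unfolding s(1) s'(1) m_def h_def p_def by (simp_all add: field_simps)
  with zero have "3 * m^2 + h^2 = 0" by (simp add: power2_eq_square algebra_simps)
  then have "(cmod p)^2 \<le> 4/3 * ((cmod (m - p))^2 + (cmod h)^2)"
    by (rule norm_le_of_quadratic_form_zero)
  also have "(cmod (m - p))^2 + (cmod h)^2 = K * (r * (1 - r))"
  proof -
    have "(cmod (m - p))^2 + (cmod h)^2
        = ((cmod ((\<sigma> + \<sigma>')/2))^2 + (cmod ((\<sigma> - \<sigma>')/2))^2) * S^2 * (r * (1 - r))"
      by (simp only: m_def h_def add_diff_cancel_left' ac distrib_right)
    \<comment> \<open>the parallelogram law\<close>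
    also have "(cmod ((\<sigma> + \<sigma>')/2))^2 + (cmod ((\<sigma> - \<sigma>')/2))^2 = ((cmod \<sigma>)^2 + (cmod \<sigma>')^2) / 2"
      unfolding cmod_power2 by (simp add: power2_eq_square field_simps)
    also have "\<dots> * S^2 = K" using K' by (auto simp: K_def field_simps)
    finally show ?thesis .
  qed
  also have "(cmod p)^2 = (r - 1/2)^2 + 1/12"
    by (simp add: p_def \<tau>_def cmod_power2 power_divide)
  finally have le: "(r - 1/2)^2 + 1/12 \<le> 4/3 * (K * (r * (1 - r)))" .
  have "K * (r * (1 - r)) \<le> 1/4 * (r * (1 - r))"
    using r K_less by (intro mult_right_mono) auto
  with le have "(r - 1/2)^2 \<le> 0" by (simp add: power2_eq_square algebra_simps)
  then have "r = 1/2" by simp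
  with le K_less show False by simp
qed

section \<open>The map and its differential\<close>

definition null_a :: "complex^4 \<Rightarrow> complex" where "null_a z = z$1 + \<i> * z$2"
definition null_b :: "complex^4 \<Rightarrow> complex" where "null_b z = z$1 - \<i> * z$2"
definition null_c :: "complex^4 \<Rightarrow> complex" where "null_c z = z$3 + \<i> * z$4"
definition null_d :: "complex^4 \<Rightarrow> complex" where "null_d z = z$3 - \<i> * z$4"

lemmas null_defs = null_a_def null_b_def null_c_def null_d_def

lemma bounded_linear_null:
  "bounded_linear null_a" "bounded_linear null_b" "bounded_linear null_c" "bounded_linear null_d"
  unfolding null_defs
  by (intro bounded_linear_add bounded_linear_sub bounded_linear_vec_nth
      bounded_linear_compose[OF bounded_linear_mult_right])+

lemma null_scale:
  "null_a (k *s z) = k * null_a z" "null_b (k *s z) = k * null_b z"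
  "null_c (k *s z) = k * null_c z" "null_d (k *s z) = k * null_d z"
  by (simp_all add: null_defs algebra_simps)

lemma null_coordinates_eqI:
  assumes "null_a x = null_a y" "null_b x = null_b y" "null_c x = null_c y" "null_d x = null_d y"
  shows "x = y"
proof -
  have z: "z$1 = (null_a z + null_b z)/2" "z$2 = (null_a z - null_b z)/(2*\<i>)"
    "z$3 = (null_c z + null_d z)/2" "z$4 = (null_c z - null_d z)/(2*\<i>)" for z
    by (simp_all add: null_defs)
  show ?thesis
    unfolding vec_eq_iff forall_4 z[of x] z[of y] using assms by simp
qed

lemma Q3_null: "z \<in> Q3 \<longleftrightarrow> null_a z * null_b z + null_c z * null_d z = 1"
  by (simp add: Q3_def null_defs power2_eq_square algebra_simps)

lemma M3_null_norm:
  assumes "z \<in> M3 t"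
  shows "(cmod (null_a z))^2 + (cmod (null_b z))^2 + (cmod (null_c z))^2 + (cmod (null_d z))^2
    = 2 * t"
proof -
  have "(cmod (x + \<i> * y))^2 + (cmod (x - \<i> * y))^2 = 2 * ((cmod x)^2 + (cmod y)^2)" for x y
    unfolding cmod_power2 by (simp add: power2_eq_square algebra_simps)
  from this[of "z$1" "z$2"] this[of "z$3" "z$4"] show ?thesis
    using assms by (simp add: M3_def null_defs)
qed

lemma compact_M3: "compact (M3 t)"
proof -
  have "closed (M3 t)"
    unfolding M3_def Q3_def
    by (intro closed_Int closed_Collect_eq continuous_intros)
  moreover have "bounded (M3 t)"
  proof (rule boundedI)
    fix z assume "z \<in> M3 t"
    then show "norm z \<le> sqrt t"
      by (simp add: M3_def norm_vec_def L2_set_def sum_4)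
  qed
  ultimately show ?thesis by (simp add: compact_eq_bounded_closed)
qed

text \<open>
  The derivative of the defining equation of the quadric along a curve: tangent vectors lie in the
  kernel of a complex-linear form.
\<close>
lemma tangent_space_subset_quadric:
  assumes "v \<in> tangent_space M p" "M \<subseteq> Q3"
  shows "null_a p * null_b v + null_a v * null_b p + (null_c p * null_d v + null_c v * null_d p) = 0"
proof -
  obtain \<gamma> \<epsilon> where \<gamma>: "\<epsilon> > 0" "\<gamma> ` {-\<epsilon><..<\<epsilon>} \<subseteq> M" "\<gamma> 0 = p"
      "(\<gamma> has_vector_derivative v) (at (0::real))"
    using assms(1) unfolding tangent_space_def by blast
  note lin = bounded_linear_null[THEN bounded_linear.has_vector_derivative, OF \<gamma>(4)]
  have "((\<lambda>x. null_a (\<gamma> x) * null_b (\<gamma> x) + null_c (\<gamma> x) * null_d (\<gamma> x)) has_vector_derivative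
      (null_a p * null_b v + null_a v * null_b p + (null_c p * null_d v + null_c v * null_d p))) (at 0)"
    using has_vector_derivative_add[OF has_vector_derivative_mult[OF lin(1,2)]
        has_vector_derivative_mult[OF lin(3,4)]]
    by (simp only: \<gamma>(3))
  moreover have "((\<lambda>x. null_a (\<gamma> x) * null_b (\<gamma> x) + null_c (\<gamma> x) * null_d (\<gamma> x))
      has_vector_derivative 0) (at 0)"
    by (rule has_vector_derivative_transform_within_open
        [OF has_vector_derivative_const, where S = "{-\<epsilon><..<\<epsilon>}"])
       (use \<gamma> assms(2) in \<open>auto simp: subset_iff Q3_null\<close>)
  ultimately show ?thesis by (rule vector_derivative_unique_at)
qed

definition embedding_map :: "complex^4 \<Rightarrow> complex^3" where
  "embedding_map z = axis 1 (null_a z) + axis 2 (null_c z)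
     + axis 3 (fibre_polynomial (null_a z) (null_b z) (null_c z) (null_d z))"

lemma embedding_map_components:
  "embedding_map z $ 1 = null_a z" "embedding_map z $ 2 = null_c z"
  "embedding_map z $ 3 = fibre_polynomial (null_a z) (null_b z) (null_c z) (null_d z)"
  by (simp_all add: embedding_map_def axis_def)

definition embedding_differential :: "complex^4 \<Rightarrow> complex^4 \<Rightarrow> complex^3" where
  "embedding_differential z v = axis 1 (null_a v) + axis 2 (null_c v)
     + axis 3 ((null_b v * null_d z + null_b z * null_d v) * (null_a z * null_b z - 3 * \<tau>^2)
         + null_b z * null_d z * (null_a v * null_b z + null_a z * null_b v))"

lemma bounded_linear_axis: "bounded_linear (axis i :: complex \<Rightarrow> complex^'n)"
  by (intro linear_conv_bounded_linear[THEN iffD1] linearI)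
     (simp_all add: vec_eq_iff axis_def)

lemma embedding_map_has_derivative:
  "(embedding_map has_derivative embedding_differential z) (at z within A)"
  unfolding embedding_map_def embedding_differential_def fibre_polynomial_def
  by (rule derivative_eq_intros bounded_linear.has_derivative[OF bounded_linear_axis]
       bounded_linear_imp_has_derivative bounded_linear_null refl)+
     (simp add: algebra_simps fun_eq_iff)

lemma polynomial_function_embedding_map: "polynomial_function embedding_map"
  unfolding embedding_map_def fibre_polynomial_def
  by (intro polynomial_function_add polynomial_function_diff polynomial_function_complex_mult
      polynomial_function_bounded_linear_compose[OF bounded_linear_axis]
      polynomial_function_bounded_linear bounded_linear_null polynomial_function_const)

lemma embedding_differential_scale:
  "embedding_differential z (k *s v) = k *s embedding_differential z v"
  by (simp add: vec_eq_iff forall_3 embedding_differential_def axis_def null_scale algebra_simps)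

lemma embedding_map_inj_on:
  assumes "t^2 < 5/4"
  shows "inj_on embedding_map (M3 t)"
proof (rule inj_onI)
  fix x y assume x: "x \<in> M3 t" and y: "y \<in> M3 t" and eq: "embedding_map x = embedding_map y"
  from eq have a: "null_a y = null_a x" and c: "null_c y = null_c x"
    and f: "fibre_polynomial (null_a y) (null_b y) (null_c y) (null_d y)
      = fibre_polynomial (null_a x) (null_b x) (null_c x) (null_d x)"
    by (metis embedding_map_components)+
  have qx: "null_a x * null_b x + null_c x * null_d x = 1"
    using x by (simp add: M3_def flip: Q3_null)
  have qy: "null_a x * null_b y + null_c x * null_d y = 1"
    using y by (simp add: M3_def flip: Q3_null a c)
  obtain s where s: "null_b y = null_b x + s * null_c x" "null_d y = null_d x - s * null_a x"
    using quadric_fibre_is_line[OF qx qy] .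
  have "s = 0"
    using fibre_polynomial_diff[OF qx s] f a c
      fibre_cubic_factor_nonzero[OF qx qy M3_null_norm[OF x] _ assms] M3_null_norm[OF y]
    by simp
  with s a c show "x = y" by (intro null_coordinates_eqI) simp_all
qed

text \<open>
  A tangent vector killed by the first two components is a multiple \<open>s\<close> of the direction
  \<open>(c, - a)\<close> of the fibre, and the third component maps it to \<open>- 3s(ab - \<tau>)\<^sup>2\<close>, the
  infinitesimal case of the difference formula for \<open>fibre_polynomial\<close>.
\<close>
lemma embedding_differential_inj_on:
  assumes "t^2 < 5/4" "p \<in> M3 t"
  shows "inj_on (embedding_differential p) (tangent_space (M3 t) p)"
proof (rule inj_onI)
  fix v w assume v: "v \<in> tangent_space (M3 t) p" and w: "w \<in> tangent_space (M3 t) p"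
    and eq: "embedding_differential p v = embedding_differential p w"
  have MQ: "M3 t \<subseteq> Q3" by (auto simp: M3_def)
  \<comment> \<open>\<open>u\<close> need not be a tangent vector, but it satisfies the linear equation of the quadric.\<close>
  define u where "u = v - w"
  have u_simps: "null_a u = null_a v - null_a w" "null_b u = null_b v - null_b w"
    "null_c u = null_c v - null_c w" "null_d u = null_d v - null_d w"
    by (simp_all add: u_def null_defs algebra_simps)
  have "embedding_differential p v $ i = embedding_differential p w $ i" for i
    by (simp add: eq)
  from this[of 1] this[of 2] this[of 3]
  have a: "null_a v = null_a w" and c: "null_c v = null_c w"
    and f: "(null_b u * null_d p + null_b p * null_d u) * (null_a p * null_b p - 3 * \<tau>^2)
         + null_b p * null_d p * (null_a p * null_b u) = 0"
    by (simp_all add: embedding_differential_def axis_def u_simps algebra_simps)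
  have T: "null_a p * null_b u + null_c p * null_d u = 0"
    using tangent_space_subset_quadric[OF v MQ] tangent_space_subset_quadric[OF w MQ] a c
    unfolding u_simps by algebra
  have q: "null_a p * null_b p + null_c p * null_d p = 1"
    using assms(2) by (simp add: M3_def flip: Q3_null)
  \<comment> \<open>Cramer's rule for \<open>(b, d)\<close> and \<open>(c, - a)\<close>, whose determinant is \<open>- 1\<close> on the quadric\<close>
  define s where "s = null_b u * null_d p - null_d u * null_b p"
  have b: "null_b u = s * null_c p" and d: "null_d u = - s * null_a p"
    unfolding s_def using T q by algebra+
  have "s * (3 * (null_a p * null_b p - \<tau>)^2) = 0"
    using f q \<tau>_quadratic unfolding b d by algebra
  moreover have "3 * (null_a p * null_b p - \<tau>)^2 \<noteq> 0"
    using fibre_cubic_factor_nonzero[OF q q M3_null_norm[OF assms(2)] M3_null_norm[OF assms(2)] assms(1)]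
    by (simp add: power2_eq_square)
  ultimately have "s = 0" by simp
  then show "v = w"
    using a c b d by (intro null_coordinates_eqI) (simp_all add: u_simps)
qed

theorem theorem1p2:
  fixes t :: real
  assumes "1 < t" and "t < sqrt 5 / 2"
  shows "\<exists>f :: complex^4 \<Rightarrow> complex^3. real_analytic_CR_embedding (M3 t) f"
proof -
  have "t^2 < (sqrt 5 / 2)^2" using assms by (intro power_strict_mono) auto
  then have t: "t^2 < 5/4" by (simp add: power_divide)
  have "continuous_on (M3 t) embedding_map"
    using polynomial_function_embedding_map by (rule continuous_on_polymonial_function)
  then have "\<exists>g. homeomorphism (M3 t) (embedding_map ` M3 t) embedding_map g"
    using compact_M3 embedding_map_inj_on[OF t] by (metis homeomorphism_compact)
  then have "embedding_on (M3 t) embedding_map"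
    unfolding embedding_on_def immersion_on_def
    using embedding_map_inj_on[OF t] embedding_map_has_derivative
      embedding_differential_inj_on[OF t] by blast
  moreover have "real_analytic_map_on (M3 t) embedding_map"
    unfolding real_analytic_map_on_def
    using polynomial_function_real_analytic_at[OF polynomial_function_embedding_map]
    by (metis UNIV_I open_UNIV)
  moreover have "CR_map_on (M3 t) embedding_map"
    unfolding CR_map_on_def
    using embedding_map_has_derivative embedding_differential_scale by blast
  ultimately show ?thesis
    unfolding real_analytic_CR_embedding_def by blast
qed

end
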